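(* Let $\mathbb{K}$ be a field and let $G$ be a graph with vertex set $[\ell]=\{1,\dots,\ell\}$. Then $$\{\theta_{W,T}^{\bm a}\mid (W,T)\in P_G,\ \bm a\in\mathbb{Z}^\ell_T\}$$ is a $\mathbb{K}$-basis of $D_R(\mathcal{A}_G)$.
   Context: Graphs are finite and simple (not assumed connected here), $\ell\ge1$. $S=\mathbb{K}[x_1,\dots,x_\ell]$, $\mathrm{Der}(S)=\bigoplus_{i=1}^\ell S\,\partial_{x_i}$, and $R=\mathbb{K}[x_i-x_j\mid 1\le i<j\le \ell]\subset S$. The logarithmic vector field of the graphic arrangement $\mathcal{A}_G$ is $D(\mathcal{A}_G)=\{\theta\in \mathrm{Der}(S)\mid \theta(x_u-x_v)\in (x_u-x_v)S \text{ for every edge }\{u,v\}\text{ of }G\}$, and $D_R(\mathcal{A}_G)=D(\mathcal{A}_G)\cap\big(\bigoplus_{i=1}^\ell R\,\partial_{x_i}\big)$. $P_G=\{(V(C),T)\mid T\subsetneq[\ell],\ C \text{ a connected component of } G-T\}$, where $G-T$ is obtained from $G$ by deleting the vertices in $T$ and $V(C)$ is the vertex set of $C$. For $T\subset[\ell]$, $\mathbb{Z}^\ell_T=\{\bm a=(a_1,\dots,a_\ell)\in\mathbb{Z}_{\ge0}^\ell\mid a_i=0 \text{ for } i\notin T\}$. For $T\subsetneq[\ell]$, $W\subset[\ell]\setminus T$ and $\bm a\in\mathbb{Z}_T^\ell$, $$\theta^{\bm a}_{W,T}=\sum_{v\in W}\Big(\prod_{t\in T}(x_t-x_v)^{1+a_t}\Big)\partial_{x_v}\in\mathrm{Der}(S).$$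 *)

theory Defs
  imports "HOL-Library.Poly_Mapping" "Graph_Theory.Digraph_Component"
begin

section \<open>Polynomials and derivations\<close>

text \<open>
  A polynomial over \<open>'k\<close> is a finitely supported family of coefficients indexed by monomials,
  and a monomial is a finitely supported family of exponents indexed by the variables
  \<open>x\<^sub>i\<close>, \<open>i\<close> a natural number.  The ring $S$ in the variables
  \<open>x\<^sub>1, \<dots>, x\<^sub>l\<close> is carved out of this type as a subalgebra.
\<close>

type_synonym 'k mpoly = "(nat \<Rightarrow>\<^sub>0 nat) \<Rightarrow>\<^sub>0 'k"

definition const :: "'k::zero \<Rightarrow> 'k mpoly" where
  "const c = Poly_Mapping.single 0 c"

definition X :: "nat \<Rightarrow> 'k::zero_neq_one mpoly" where
  "X i = Poly_Mapping.single (Poly_Mapping.single i 1) 1"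

inductive_set subalgebra :: "'k::field mpoly set \<Rightarrow> 'k mpoly set" for A where
  const: "const c \<in> subalgebra A"
| gen: "p \<in> A \<Longrightarrow> p \<in> subalgebra A"
| add: "p \<in> subalgebra A \<Longrightarrow> q \<in> subalgebra A \<Longrightarrow> p + q \<in> subalgebra A"
| mult: "p \<in> subalgebra A \<Longrightarrow> q \<in> subalgebra A \<Longrightarrow> p * q \<in> subalgebra A"

definition S_ring :: "nat \<Rightarrow> 'k::field mpoly set" where
  "S_ring l = subalgebra (X ` {1..l})"

definition R_ring :: "nat \<Rightarrow> 'k::field mpoly set" where
  "R_ring l = subalgebra {X i - X j | i j. 1 \<le> i \<and> i < j \<and> j \<le> l}"

text \<open>
  On a monomial in which \<open>x\<^sub>i\<close> does not occur the truncated exponent subtraction is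
  harmless, because the coefficient \<open>of_nat 0\<close> vanishes.
\<close>

definition partial :: "nat \<Rightarrow> 'k::field mpoly \<Rightarrow> 'k mpoly" where
  "partial i p = (\<Sum>m\<in>Poly_Mapping.keys p.
     Poly_Mapping.single (m - Poly_Mapping.single i 1)
       (of_nat (Poly_Mapping.lookup m i) * Poly_Mapping.lookup p m))"

text \<open>
  The derivation \<open>\<Sum>\<^sub>i f\<^sub>i \<partial>\<^sub>i\<close> is represented by its finitely supported coefficient
  family \<open>f\<close>; thus \<open>Poly_Mapping.single i f\<close> stands for \<open>f \<partial>\<^sub>i\<close>.
\<close>

type_synonym 'k der = "nat \<Rightarrow>\<^sub>0 'k mpoly"

definition free_der :: "nat \<Rightarrow> 'k::field mpoly set \<Rightarrow> 'k der set" where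
  "free_der l A = {\<theta>. Poly_Mapping.keys \<theta> \<subseteq> {1..l} \<and>
     (\<forall>i\<in>{1..l}. Poly_Mapping.lookup \<theta> i \<in> A)}"

definition Der :: "nat \<Rightarrow> 'k::field der set" where
  "Der l = free_der l (S_ring l)"

definition der_apply :: "'k::field der \<Rightarrow> 'k mpoly \<Rightarrow> 'k mpoly" where
  "der_apply \<theta> p = (\<Sum>i\<in>Poly_Mapping.keys \<theta>. Poly_Mapping.lookup \<theta> i * partial i p)"

definition der_scale :: "'k::field \<Rightarrow> 'k der \<Rightarrow> 'k der" where
  "der_scale c \<theta> = Poly_Mapping.map (\<lambda>p. const c * p) \<theta>"

lemma const_add: "const (a + b) = const a + const (b::'k::field)"
  by (simp add: const_def single_add)

lemma const_mult: "const (a * b) = const a * const (b::'k::field)"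
  by (simp add: const_def mult_single)

lemma const_one: "const (1::'k::field) = 1"
  by (simp add: const_def)

lemma lookup_der_scale:
  "Poly_Mapping.lookup (der_scale c \<theta>) i = const c * Poly_Mapping.lookup \<theta> i"
  by (simp add: der_scale_def Poly_Mapping.map.rep_eq when_def)

global_interpretation der: vector_space der_scale
  by standard (auto intro!: poly_mapping_eqI
      simp: lookup_der_scale lookup_add const_add const_mult const_one algebra_simps)

section \<open>Logarithmic vector fields of graphic arrangements\<close>

text \<open>
  A simple graph is a \<open>pair_graph\<close>: a finite loop-free digraph without multiple arcs whose
  arc relation is symmetric, the edge \<open>{u,v}\<close> being the pair of arcs \<open>(u,v)\<close>, \<open>(v,u)\<close>.
  By symmetry its connected components are its strongly connected components \<open>sccs\<close>.
\<close>

definition log_der :: "nat \<Rightarrow> nat pair_pre_digraph \<Rightarrow> 'k::field der set" where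
  "log_der l G = {\<theta> \<in> Der l. \<forall>(u, v)\<in>parcs G.
     \<exists>q\<in>S_ring l. der_apply \<theta> (X u - X v) = (X u - X v) * q}"

definition log_der_R :: "nat \<Rightarrow> nat pair_pre_digraph \<Rightarrow> 'k::field der set" where
  "log_der_R l G = log_der l G \<inter> free_der l (R_ring l)"

definition P_set :: "nat pair_pre_digraph \<Rightarrow> (nat set \<times> nat set) set" where
  "P_set G = {(verts C, T) | C T. T \<subset> pverts G \<and>
     C \<in> pre_digraph.sccs (with_proj G \<restriction> (pverts G - T))}"

definition Z_set :: "nat set \<Rightarrow> (nat \<Rightarrow> nat) set" where
  "Z_set T = {a. \<forall>i. i \<notin> T \<longrightarrow> a i = 0}"

definition theta :: "nat set \<Rightarrow> nat set \<Rightarrow> (nat \<Rightarrow> nat) \<Rightarrow> 'k::field der" where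
  "theta W T a = (\<Sum>v\<in>W. Poly_Mapping.single v (\<Prod>t\<in>T. (X t - X v) ^ (1 + a t)))"

end

theory Submission
  imports Defs
begin

text \<open>
  Fix a vertex \<open>v\<close>.  Since $R$ is generated by the differences of the variables, its elements are
  invariant under the substitution sending every \<open>x\<^sub>i\<close> to \<open>x\<^sub>i - x\<^sub>v\<close>, so a polynomial \<open>f\<close> in $R$ is
  the combination of the products \<open>\<Prod>\<^sub>t (x\<^sub>t - x\<^sub>v)\<^bsup>m t\<^esup>\<close>, over the monomials \<open>m\<close> without \<open>x\<^sub>v\<close>, whose
  coefficients are simply the coefficients of \<open>f\<close> at those \<open>m\<close>
  (\<open>translate_R_ring\<close>, \<open>R_ring_eq_0I\<close>).  Conversely, modulo \<open>x\<^sub>v\<close> such a product is the monomial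
  \<open>m\<close> itself (\<open>lookup_shifted_monomial\<close>).  Hence the products are a basis of $R$, with the
  coefficients at monomials avoiding \<open>x\<^sub>v\<close> as coordinates, and a derivation
  \<open>\<Sum>\<^sub>v f\<^sub>v \<partial>\<^sub>v\<close> over $R$ has as its coordinates the coefficients \<open>c\<^sub>v(m)\<close> of \<open>f\<^sub>v\<close> at the monomials
  \<open>m\<close> avoiding \<open>x\<^sub>v\<close>.

  In these coordinates the divisibility condition at an edge \<open>{u,v}\<close> is transparent.  A multiple of
  \<open>x\<^sub>u - x\<^sub>v\<close> has coefficient zero at each monomial avoiding both \<open>x\<^sub>u\<close> and \<open>x\<^sub>v\<close>, so \<open>c\<^sub>u(m) = c\<^sub>v(m)\<close>
  for every such \<open>m\<close> (\<open>lookup_eq_if_edge\<close>).  Thus, if \<open>T\<close> is the set of variables in \<open>m\<close>, the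
  function sending \<open>v\<close> to \<open>c\<^sub>v(m)\<close> is constant on each component of $G - T$.  The derivation
  \<open>\<theta>\<close> attached to a component \<open>W\<close> of $G - T$ and an exponent vector is exactly the one whose
  coordinates are the indicator of \<open>W\<close> at one monomial with support \<open>T\<close>, and zero at all others
  (\<open>coefficient_theta\<close>); it is logarithmic by \<open>theta_in_log_der_R\<close>.  Indicators of components
  span the functions constant on components, which gives the spanning property
  (\<open>log_der_R_subset_span\<close>), and different indices have coordinates of disjoint nonempty
  support, which gives independence.
\<close>

section \<open>Monomials and translation\<close>

lemma poly_mapping_eq_sum_single:
  fixes p :: "'a \<Rightarrow>\<^sub>0 'b::comm_monoid_add"
  shows "p = (\<Sum>m\<in>Poly_Mapping.keys p. Poly_Mapping.single m (Poly_Mapping.lookup p m))"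
proof (rule poly_mapping_eqI)
  fix k
  have "Poly_Mapping.lookup p k =
      (\<Sum>m\<in>Poly_Mapping.keys p. if m = k then Poly_Mapping.lookup p m else 0)"
    by (auto simp: in_keys_iff)
  then show "Poly_Mapping.lookup p k = Poly_Mapping.lookup
      (\<Sum>m\<in>Poly_Mapping.keys p. Poly_Mapping.single m (Poly_Mapping.lookup p m)) k"
    by (simp add: lookup_sum lookup_single when_def)
qed

lemma power_X: "X t ^ k = (Poly_Mapping.single (Poly_Mapping.single t k) 1 :: 'k::field mpoly)"
  by (induction k) (simp_all add: X_def mult_single flip: single_add)

lemma prod_single_one:
  "(\<Prod>t\<in>A. Poly_Mapping.single (f t) (1::'k::field)) =
     Poly_Mapping.single (\<Sum>t\<in>A. f t :: nat \<Rightarrow>\<^sub>0 nat) 1"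
  by (induction A rule: infinite_finite_induct) (simp_all add: mult_single)

lemma monomial_eq_prod_X:
  "(Poly_Mapping.single m 1 :: 'k::field mpoly) =
     (\<Prod>t\<in>Poly_Mapping.keys m. X t ^ Poly_Mapping.lookup m t)"
  by (simp add: power_X prod_single_one flip: poly_mapping_eq_sum_single)

lemma lookup_X_mult_eq_0:
  assumes "u \<notin> Poly_Mapping.keys m"
  shows "Poly_Mapping.lookup (X u * q :: 'k::field mpoly) m = 0"
proof (rule ccontr)
  assume "Poly_Mapping.lookup (X u * q) m \<noteq> 0"
  then have "m \<in> Poly_Mapping.keys (X u * q)"
    by (simp add: in_keys_iff)
  with keys_mult[of "X u" q] obtain b where "m = Poly_Mapping.single u 1 + b"
    by (auto simp: X_def)
  then have "Poly_Mapping.lookup m u \<noteq> 0"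
    by (simp add: lookup_add)
  with assms show False
    by (simp add: in_keys_iff)
qed

text \<open>The value of the monomial \<open>m\<close> under the substitution \<open>x\<^sub>t \<mapsto> x\<^sub>t - x\<^sub>v\<close>.\<close>

definition shifted_monomial :: "nat \<Rightarrow> (nat \<Rightarrow>\<^sub>0 nat) \<Rightarrow> 'k::field mpoly" where
  "shifted_monomial v m =
     (\<Prod>t\<in>Poly_Mapping.keys m. (X t - X v) ^ Poly_Mapping.lookup m t)"

lemma shifted_monomial_superset:
  assumes "finite A" "Poly_Mapping.keys m \<subseteq> A"
  shows "shifted_monomial v m = (\<Prod>t\<in>A. (X t - X v) ^ Poly_Mapping.lookup m t)"
  unfolding shifted_monomial_def using assms
  by (intro prod.mono_neutral_left) (auto simp: in_keys_iff)

lemma shifted_monomial_add: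
  "shifted_monomial v (m + n) = (shifted_monomial v m * shifted_monomial v n :: 'k::field mpoly)"
proof -
  let ?A = "Poly_Mapping.keys m \<union> Poly_Mapping.keys n"
  have "Poly_Mapping.keys (m + n) \<subseteq> ?A"
    by (rule keys_add)
  then show ?thesis
    by (simp add: shifted_monomial_superset[of ?A] lookup_add power_add prod.distrib)
qed

lemma shifted_monomial_eq_0:
  "v \<in> Poly_Mapping.keys m \<Longrightarrow> shifted_monomial v m = (0 :: 'k::field mpoly)"
  by (force simp: shifted_monomial_def in_keys_iff intro!: prod_zero)

text \<open>
  The substitution \<open>x\<^sub>t \<mapsto> x\<^sub>t - x\<^sub>v\<close> on polynomials, defined by linear extension from monomials;
  the lemmas below show that it is a ring homomorphism.
\<close>

definition translate :: "nat \<Rightarrow> 'k::field mpoly \<Rightarrow> 'k mpoly" where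
  "translate v p =
     (\<Sum>m\<in>Poly_Mapping.keys p. const (Poly_Mapping.lookup p m) * shifted_monomial v m)"

lemma const_0: "const (0::'k::field) = 0"
  by (simp add: const_def)

lemma translate_superset:
  assumes "finite A" "Poly_Mapping.keys p \<subseteq> A"
  shows "translate v p = (\<Sum>m\<in>A. const (Poly_Mapping.lookup p m) * shifted_monomial v m)"
  unfolding translate_def using assms
  by (intro sum.mono_neutral_left) (auto simp: in_keys_iff const_0)

lemma translate_add: "translate v (p + q) = translate v p + translate v q"
proof -
  let ?A = "Poly_Mapping.keys p \<union> Poly_Mapping.keys q"
  have "Poly_Mapping.keys (p + q) \<subseteq> ?A"
    by (rule keys_add)
  then show ?thesis
    by (simp add: translate_superset[of ?A] lookup_add const_add distrib_right sum.distrib)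
qed

lemma translate_sum: "translate v (\<Sum>a\<in>A. f a) = (\<Sum>a\<in>A. translate v (f a))"
  by (induction A rule: infinite_finite_induct) (simp_all add: translate_add, simp_all add: translate_def)

lemma translate_single: "translate v (Poly_Mapping.single m c) = const c * shifted_monomial v m"
  by (simp add: translate_def const_0)

lemma translate_diff: "translate v (p - q) = translate v p - translate v q"
  using translate_add[of v "p - q" q] by (simp add: algebra_simps)

lemma translate_mult: "translate v (p * q) = translate v p * translate v q"
proof -
  have "p * q = (\<Sum>m\<in>Poly_Mapping.keys p. \<Sum>n\<in>Poly_Mapping.keys q.
      Poly_Mapping.single (m + n) (Poly_Mapping.lookup p m * Poly_Mapping.lookup q n))"
    by (subst poly_mapping_eq_sum_single[of p], subst poly_mapping_eq_sum_single[of q])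
       (simp add: sum_product mult_single)
  then have "translate v (p * q) = (\<Sum>m\<in>Poly_Mapping.keys p. \<Sum>n\<in>Poly_Mapping.keys q.
      const (Poly_Mapping.lookup p m * Poly_Mapping.lookup q n) * shifted_monomial v (m + n))"
    by (simp add: translate_sum translate_single)
  then show ?thesis
    by (simp add: translate_def sum_product const_mult shifted_monomial_add algebra_simps)
qed

lemma translate_X: "translate v (X i) = X i - X v"
  by (simp add: X_def[of i] translate_single const_one shifted_monomial_def)

section \<open>The subalgebras \<open>R\<close> and \<open>S\<close>\<close>

text \<open>
  Differences of variables are fixed by the substitution, and it is a homomorphism.  Expanding the
  left-hand side therefore writes \<open>f\<close> in terms of the differences with \<open>x\<^sub>v\<close>.
\<close>

lemma translate_R_ring:
  assumes "f \<in> R_ring l"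
  shows "translate v f = f"
  using assms unfolding R_ring_def
proof (induction rule: subalgebra.induct)
  case (const c)
  have "translate v (const c) = translate v (Poly_Mapping.single 0 c)"
    by (simp add: const_def)
  also have "\<dots> = const c"
    by (simp add: translate_single shifted_monomial_def)
  finally show ?case .
qed (auto simp: translate_add translate_mult translate_diff translate_X)

text \<open>
  In the expansion just described, the monomials containing \<open>x\<^sub>v\<close> contribute a factor
  \<open>x\<^sub>v - x\<^sub>v = 0\<close>, so the coefficients at the other monomials determine \<open>f\<close>.
\<close>

lemma R_ring_eq_0I:
  assumes "f \<in> R_ring l"
    and "\<And>m. v \<notin> Poly_Mapping.keys m \<Longrightarrow> Poly_Mapping.lookup f m = 0"
  shows "f = 0"
proof -
  have "const (Poly_Mapping.lookup f m) * shifted_monomial v m = 0" for m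
    using assms(2)[of m] shifted_monomial_eq_0[of v m]
    by (cases "v \<in> Poly_Mapping.keys m") (auto simp: const_0)
  then have "translate v f = 0"
    by (simp only: translate_def sum.neutral_const)
  then show ?thesis
    using translate_R_ring[OF assms(1)] by simp
qed

lemma subalgebra_0: "0 \<in> subalgebra A"
  using subalgebra.const[of 0 A] by (simp add: const_0)

lemma subalgebra_1: "1 \<in> subalgebra A"
  using subalgebra.const[of 1 A] by (simp add: const_one)

lemma subalgebra_uminus: "p \<in> subalgebra A \<Longrightarrow> - p \<in> subalgebra A"
  using subalgebra.mult[OF subalgebra.const[of "- 1" A]]
  by (fastforce simp: const_def single_uminus)

lemma subalgebra_diff: "p \<in> subalgebra A \<Longrightarrow> q \<in> subalgebra A \<Longrightarrow> p - q \<in> subalgebra A"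
  using subalgebra.add[OF _ subalgebra_uminus, of p A q] by simp

lemma subalgebra_power: "p \<in> subalgebra A \<Longrightarrow> p ^ n \<in> subalgebra A"
  by (induction n) (auto intro: subalgebra_1 subalgebra.mult)

lemma subalgebra_prod:
  "(\<And>t. t \<in> T \<Longrightarrow> f t \<in> subalgebra A) \<Longrightarrow> (\<Prod>t\<in>T. f t) \<in> subalgebra A"
  by (induction T rule: infinite_finite_induct) (auto intro: subalgebra_1 subalgebra.mult)

text \<open>
  Congruence modulo \<open>z\<close> is compatible with products.  Divisibility in the whole polynomial type would
  not suffice: logarithmic derivations require the quotient to lie in $S$, hence the
  formulation relative to a subalgebra.
\<close>

lemma subalgebra_cong_prod:
  assumes "\<And>t. t \<in> T \<Longrightarrow> f t \<in> subalgebra A" "\<And>t. t \<in> T \<Longrightarrow> g t \<in> subalgebra A"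
    and "\<And>t. t \<in> T \<Longrightarrow> \<exists>q\<in>subalgebra A. f t - g t = z * q"
  shows "\<exists>q\<in>subalgebra A. (\<Prod>t\<in>T. f t) - (\<Prod>t\<in>T. g t) = z * q"
  using assms
proof (induction T rule: infinite_finite_induct)
  case (insert x T)
  then obtain q r where q: "q \<in> subalgebra A" "f x - g x = z * q"
    and r: "r \<in> subalgebra A" "prod f T - prod g T = z * r"
    by (metis insertI1 insertI2)
  have "prod f (insert x T) - prod g (insert x T) =
      f x * (prod f T - prod g T) + (f x - g x) * prod g T"
    using insert.hyps by (simp add: algebra_simps)
  also have "\<dots> = z * (f x * r + q * prod g T)"
    by (simp add: q r algebra_simps)
  finally show ?case
    using insert.prems q r
    by (intro bexI[of _ "f x * r + q * prod g T"])
       (auto intro!: subalgebra.add subalgebra.mult subalgebra_prod)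
qed (auto intro: bexI[of _ 0] subalgebra_0)

lemma subalgebra_cong_power:
  assumes "p \<in> subalgebra A" "r \<in> subalgebra A" "\<exists>q\<in>subalgebra A. p - r = z * q"
  shows "\<exists>q\<in>subalgebra A. p ^ n - r ^ n = z * q"
  \<comment> \<open>a power is a constant product\<close>
  using subalgebra_cong_prod[of "{..<n}" "\<lambda>_. p" A "\<lambda>_. r" z] assms by simp

text \<open>
  Modulo \<open>x\<^sub>v\<close> the shifted monomial equals \<open>m\<close>, and multiples of \<open>x\<^sub>v\<close> do not involve the monomial
  \<open>n\<close>.
\<close>

lemma lookup_shifted_monomial:
  assumes "v \<notin> Poly_Mapping.keys m" "v \<notin> Poly_Mapping.keys n"
  shows "Poly_Mapping.lookup (shifted_monomial v m :: 'k::field mpoly) n = (if m = n then 1 else 0)"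
proof -
  have all: "p \<in> subalgebra UNIV" for p :: "'k mpoly"
    by (simp add: subalgebra.gen)
  have "\<exists>q\<in>subalgebra UNIV. (X t - X v) - X t = X v * (q :: 'k mpoly)" for t
    by (rule bexI[of _ "-1"]) (simp_all add: all)
  then have "\<exists>q\<in>subalgebra UNIV. shifted_monomial v m -
      (\<Prod>t\<in>Poly_Mapping.keys m. X t ^ Poly_Mapping.lookup m t) = X v * (q :: 'k mpoly)"
    unfolding shifted_monomial_def
    by (intro subalgebra_cong_prod subalgebra_cong_power) (simp_all add: all)
  then obtain q :: "'k mpoly" where "shifted_monomial v m - Poly_Mapping.single m 1 = X v * q"
    by (auto simp: monomial_eq_prod_X)
  then have "shifted_monomial v m = Poly_Mapping.single m 1 + X v * q"
    by (simp add: algebra_simps)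
  then show ?thesis
    using assms by (simp add: lookup_add lookup_X_mult_eq_0 lookup_single when_def)
qed

lemma keys_S_ring:
  assumes "f \<in> S_ring l" "m \<in> Poly_Mapping.keys f"
  shows "Poly_Mapping.keys m \<subseteq> {1..l}"
  using assms unfolding S_ring_def
proof (induction arbitrary: m rule: subalgebra.induct)
  case (const c)
  then show ?case by (auto simp: const_def split: if_splits)
next
  case (gen p)
  then show ?case by (auto simp: X_def split: if_splits)
next
  case (add p q)
  then show ?case using keys_add[of p q] by blast
next
  case (mult p q)
  then obtain a b where "m = a + b" "a \<in> Poly_Mapping.keys p" "b \<in> Poly_Mapping.keys q"
    using keys_mult[of p q] by blast
  then show ?case using mult.IH keys_add[of a b] by blast
qed

lemma X_in_S_ring: "i \<in> {1..l} \<Longrightarrow> X i \<in> S_ring l"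
  unfolding S_ring_def by (intro subalgebra.gen) auto

lemma X_diff_in_R_ring:
  assumes "i \<in> {1..l}" "j \<in> {1..l}"
  shows "X i - X j \<in> R_ring l"
proof -
  let ?D = "{X i - X j | i j. 1 \<le> i \<and> i < j \<and> j \<le> l}"
  consider "i = j" | "i < j" | "j < i" by linarith
  then show ?thesis
  proof cases
    case 1
    then show ?thesis by (simp add: R_ring_def subalgebra_0)
  next
    case 2
    then show ?thesis using assms unfolding R_ring_def by (intro subalgebra.gen) auto
  next
    case 3
    then have "X j - X i \<in> subalgebra ?D" using assms by (intro subalgebra.gen) auto
    from subalgebra_uminus[OF this] show ?thesis by (simp add: R_ring_def)
  qed
qed

lemma R_ring_subset_S_ring: "R_ring l \<subseteq> S_ring l"
proof
  fix f :: "'k::field mpoly"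
  assume "f \<in> R_ring l"
  then show "f \<in> S_ring l"
    unfolding R_ring_def
  proof (induction rule: subalgebra.induct)
    case (gen p)
    then obtain i j where p: "p = X i - X j" and "1 \<le> i" "i < j" "j \<le> l"
      by blast
    then have "X i \<in> S_ring l" "X j \<in> S_ring l"
      by (simp_all add: X_in_S_ring)
    then show ?case
      unfolding p S_ring_def by (rule subalgebra_diff)
  qed (auto simp: S_ring_def intro: subalgebra.intros)
qed

section \<open>Logarithmic derivations\<close>

lemma partial_X: "partial i (X u) = (if i = u then 1 else 0 :: 'k::field mpoly)"
  by (simp add: partial_def X_def lookup_single when_def)

lemma partial_diff: "partial i (p - q) = (partial i p - partial i q :: 'k::field mpoly)"
proof -
  let ?A = "Poly_Mapping.keys p \<union> Poly_Mapping.keys q"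
  have sup: "partial i r = (\<Sum>m\<in>?A. Poly_Mapping.single (m - Poly_Mapping.single i 1)
     (of_nat (Poly_Mapping.lookup m i) * Poly_Mapping.lookup r m))"
    if "Poly_Mapping.keys r \<subseteq> ?A" for r :: "'k mpoly"
    unfolding partial_def using that by (intro sum.mono_neutral_left) (auto simp: in_keys_iff)
  have "Poly_Mapping.keys (p - q) \<subseteq> ?A"
    using keys_add[of p "- q"] by (auto simp: in_keys_iff lookup_minus)
  then show ?thesis
    by (simp add: sup lookup_minus right_diff_distrib single_diff sum_subtractf)
qed

lemma der_apply_X_diff:
  assumes "u \<noteq> v"
  shows "der_apply \<theta> (X u - X v) =
    (Poly_Mapping.lookup \<theta> u - Poly_Mapping.lookup \<theta> v :: 'k::field mpoly)"
proof -
  have "der_apply \<theta> (X u - X v) =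
      (\<Sum>i\<in>Poly_Mapping.keys \<theta>. (if i = u then Poly_Mapping.lookup \<theta> i else 0) -
        (if i = v then Poly_Mapping.lookup \<theta> i else 0))"
    unfolding der_apply_def using assms
    by (intro sum.cong) (auto simp: partial_diff partial_X)
  also have "\<dots> = Poly_Mapping.lookup \<theta> u - Poly_Mapping.lookup \<theta> v"
    by (auto simp: sum_subtractf in_keys_iff)
  finally show ?thesis .
qed

lemma log_der_R_iff:
  assumes "pair_graph G"
  shows "\<theta> \<in> log_der_R l G \<longleftrightarrow> Poly_Mapping.keys \<theta> \<subseteq> {1..l} \<and>
    (\<forall>i\<in>{1..l}. Poly_Mapping.lookup \<theta> i \<in> R_ring l) \<and>
    (\<forall>(u, v)\<in>parcs G. \<exists>q\<in>S_ring l.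
       Poly_Mapping.lookup \<theta> u - Poly_Mapping.lookup \<theta> v = (X u - X v) * q)"
proof -
  interpret pair_graph G by fact
  have apply_eq: "der_apply \<theta> (X u - X v) = Poly_Mapping.lookup \<theta> u - Poly_Mapping.lookup \<theta> v"
    if "(u, v) \<in> parcs G" for u v
    using no_loops[OF that] by (intro der_apply_X_diff) simp
  have "\<theta> \<in> log_der_R l G \<longleftrightarrow> \<theta> \<in> free_der l (R_ring l) \<and>
      (\<forall>(u, v)\<in>parcs G. \<exists>q\<in>S_ring l. der_apply \<theta> (X u - X v) = (X u - X v) * q)"
    using R_ring_subset_S_ring[of l, where 'a = 'a]
    unfolding log_der_R_def log_der_def Der_def free_der_def by blast
  also have "\<dots> \<longleftrightarrow> \<theta> \<in> free_der l (R_ring l) \<and> (\<forall>(u, v)\<in>parcs G. \<exists>q\<in>S_ring l.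
      Poly_Mapping.lookup \<theta> u - Poly_Mapping.lookup \<theta> v = (X u - X v) * q)"
    by (intro conj_cong ball_cong refl) (auto simp: apply_eq)
  finally show ?thesis
    unfolding free_der_def by blast
qed

lemma subspace_log_der_R:
  assumes "pair_graph G"
  shows "der.subspace (log_der_R l G :: 'k::field der set)"
proof (rule der.subspaceI)
  show "(0 :: 'k der) \<in> log_der_R l G"
    by (auto simp: log_der_R_iff[OF assms] R_ring_def S_ring_def
        intro: subalgebra_0 bexI[of _ 0])
next
  fix x y :: "'k der"
  assume x: "x \<in> log_der_R l G" and y: "y \<in> log_der_R l G"
  have "\<exists>q\<in>S_ring l. Poly_Mapping.lookup (x + y) u - Poly_Mapping.lookup (x + y) v = (X u - X v) * q"
    if uv: "(u, v) \<in> parcs G" for u v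
  proof -
    obtain q r where "q \<in> S_ring l" "r \<in> S_ring l"
      "Poly_Mapping.lookup x u - Poly_Mapping.lookup x v = (X u - X v) * q"
      "Poly_Mapping.lookup y u - Poly_Mapping.lookup y v = (X u - X v) * r"
      using x y uv unfolding log_der_R_iff[OF assms] by blast
    then show ?thesis
      by (intro bexI[of _ "q + r"])
         (auto simp: S_ring_def lookup_add algebra_simps intro: subalgebra.add)
  qed
  moreover have "Poly_Mapping.lookup (x + y) i \<in> R_ring l" if "i \<in> {1..l}" for i
    using x y that unfolding log_der_R_iff[OF assms] lookup_add R_ring_def
    by (blast intro: subalgebra.add)
  moreover have "Poly_Mapping.keys (x + y) \<subseteq> {1..l}"
    using x y keys_add[of x y] unfolding log_der_R_iff[OF assms] by blast
  ultimately show "x + y \<in> log_der_R l G"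
    unfolding log_der_R_iff[OF assms] by blast
next
  fix c :: 'k and x :: "'k der"
  assume x: "x \<in> log_der_R l G"
  have "\<exists>q\<in>S_ring l. Poly_Mapping.lookup (der_scale c x) u -
      Poly_Mapping.lookup (der_scale c x) v = (X u - X v) * q"
    if uv: "(u, v) \<in> parcs G" for u v
  proof -
    obtain q where q: "q \<in> S_ring l"
      "Poly_Mapping.lookup x u - Poly_Mapping.lookup x v = (X u - X v) * q"
      using x uv unfolding log_der_R_iff[OF assms] by blast
    have "Poly_Mapping.lookup (der_scale c x) u - Poly_Mapping.lookup (der_scale c x) v =
        const c * (Poly_Mapping.lookup x u - Poly_Mapping.lookup x v)"
      by (simp add: lookup_der_scale right_diff_distrib)
    also have "\<dots> = (X u - X v) * (const c * q)"
      by (simp only: q mult.left_commute)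
    finally show ?thesis
      using q(1) unfolding S_ring_def by (blast intro: subalgebra.const subalgebra.mult)
  qed
  moreover have "Poly_Mapping.lookup (der_scale c x) i \<in> R_ring l" if "i \<in> {1..l}" for i
    using x that unfolding log_der_R_iff[OF assms] lookup_der_scale R_ring_def
    by (blast intro: subalgebra.const subalgebra.mult)
  moreover have "Poly_Mapping.keys (der_scale c x) \<subseteq> Poly_Mapping.keys x"
    by (auto simp: in_keys_iff lookup_der_scale)
  then have "Poly_Mapping.keys (der_scale c x) \<subseteq> {1..l}"
    using x unfolding log_der_R_iff[OF assms] by blast
  ultimately show "der_scale c x \<in> log_der_R l G"
    unfolding log_der_R_iff[OF assms] by blast
qed

text \<open>
  The only place where the divisibility condition restricts the coordinates: the difference is a
  multiple of \<open>x\<^sub>u - x\<^sub>v\<close>, so each of its monomials contains \<open>x\<^sub>u\<close> or \<open>x\<^sub>v\<close>.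
\<close>

lemma lookup_eq_if_edge:
  assumes "pair_graph G" "\<theta> \<in> log_der_R l G" "(u, v) \<in> parcs G"
    and "u \<notin> Poly_Mapping.keys m" "v \<notin> Poly_Mapping.keys m"
  shows "Poly_Mapping.lookup (Poly_Mapping.lookup \<theta> u) m =
    Poly_Mapping.lookup (Poly_Mapping.lookup \<theta> v) m"
proof -
  obtain q where "Poly_Mapping.lookup \<theta> u - Poly_Mapping.lookup \<theta> v = (X u - X v) * q"
    using assms(2,3) unfolding log_der_R_iff[OF assms(1)] by blast
  then have "Poly_Mapping.lookup \<theta> u = Poly_Mapping.lookup \<theta> v + X u * q - X v * q"
    by (simp add: algebra_simps)
  then show ?thesis
    using assms(4,5) by (simp add: lookup_add lookup_minus lookup_X_mult_eq_0)
qed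

section \<open>Connected components after vertex deletion\<close>

lemma P_set_iff:
  assumes "pair_graph G"
  shows "(W, T) \<in> P_set G \<longleftrightarrow>
    T \<subset> pverts G \<and> W \<in> pre_digraph.sccs_verts (with_proj G \<restriction> (pverts G - T))"
proof -
  interpret pair_graph G by fact
  interpret H: wf_digraph "with_proj G \<restriction> (pverts G - T)"
    by (rule wellformed_induce_subgraph)
  show ?thesis
    by (auto simp: P_set_def H.sccs_verts_conv)
qed

lemma P_set_subset:
  assumes "pair_graph G" "(W, T) \<in> P_set G"
  shows "T \<subset> pverts G" "W \<subseteq> pverts G - T" "W \<noteq> {}"
proof -
  interpret pair_graph G by fact
  interpret H: wf_digraph "with_proj G \<restriction> (pverts G - T)"
    by (rule wellformed_induce_subgraph)
  show "T \<subset> pverts G" "W \<subseteq> pverts G - T" "W \<noteq> {}"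
    using assms(2) H.sccs_verts_subsets
    by (auto simp: P_set_iff[OF assms(1)] H.in_sccs_verts_conv_reachable)
qed

lemma P_set_disjoint:
  assumes "pair_graph G" "(W, T) \<in> P_set G" "(W', T) \<in> P_set G" "v \<in> W" "v \<in> W'"
  shows "W = W'"
proof -
  interpret pair_graph G by fact
  interpret H: wf_digraph "with_proj G \<restriction> (pverts G - T)"
    by (rule wellformed_induce_subgraph)
  show ?thesis
    using assms H.sccs_verts_disjoint[of W W'] by (auto simp: P_set_iff[OF assms(1)])
qed

lemma P_set_cover:
  assumes "pair_graph G" "v \<in> pverts G" "v \<notin> T" "T \<subseteq> pverts G"
  obtains W where "(W, T) \<in> P_set G" "v \<in> W"
proof -
  interpret pair_graph G by fact
  interpret H: wf_digraph "with_proj G \<restriction> (pverts G - T)"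
    by (rule wellformed_induce_subgraph)
  have "v \<in> verts (with_proj G \<restriction> (pverts G - T))"
    using assms by simp
  then have "H.scc_of v \<in> H.sccs_verts" "v \<in> H.scc_of v"
    by (auto intro: H.scc_of_in_sccs_verts H.in_scc_of_self)
  then show ?thesis
    using that assms by (auto simp: P_set_iff[OF assms(1)])
qed

lemma arc_induce_subgraph:
  assumes "pair_graph G" "(u, v) \<in> parcs G" "u \<notin> T" "v \<notin> T"
  shows "u \<rightarrow>\<^bsub>with_proj G \<restriction> (pverts G - T)\<^esub> v"
proof -
  interpret pair_graph G by fact
  have "u \<in> pverts G" "v \<in> pverts G"
    using assms(2) in_arcsD1 in_arcsD2 by auto
  then show ?thesis
    using assms by (auto simp: arcs_ends_def arc_to_ends_def image_iff)
qed

lemma P_set_closed: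
  assumes "pair_graph G" "(W, T) \<in> P_set G" "(u, v) \<in> parcs G" "u \<in> W" "v \<notin> T"
  shows "v \<in> W"
proof -
  interpret pair_graph G by fact
  interpret H: wf_digraph "with_proj G \<restriction> (pverts G - T)"
    by (rule wellformed_induce_subgraph)
  have "u \<notin> T"
    using P_set_subset[OF assms(1,2)] assms(4) by auto
  moreover have "(v, u) \<in> parcs G"
    using assms(3) sym_arcs by (auto simp: symmetric_def sym_def)
  ultimately have "u \<rightarrow>\<^sup>*\<^bsub>with_proj G \<restriction> (pverts G - T)\<^esub> v"
    "v \<rightarrow>\<^sup>*\<^bsub>with_proj G \<restriction> (pverts G - T)\<^esub> u"
    using arc_induce_subgraph[OF assms(1), of u v T] arc_induce_subgraph[OF assms(1), of v u T]
      assms(3,5) H.reachable_adjI by simp_all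
  moreover have "W \<in> H.sccs_verts"
    using assms(2) by (simp add: P_set_iff[OF assms(1)])
  ultimately show ?thesis
    using assms(4) unfolding H.in_sccs_verts_conv_reachable by blast
qed

lemma P_set_constant:
  assumes "pair_graph G" "(W, T) \<in> P_set G" "u \<in> W" "w \<in> W"
    and edge: "\<And>u v. (u, v) \<in> parcs G \<Longrightarrow> u \<notin> T \<Longrightarrow> v \<notin> T \<Longrightarrow> f u = f v"
  shows "f u = f w"
proof -
  interpret pair_graph G by fact
  let ?H = "with_proj G \<restriction> (pverts G - T)"
  interpret H: wf_digraph ?H
    by (rule wellformed_induce_subgraph)
  have "u \<rightarrow>\<^sup>*\<^bsub>?H\<^esub> w"
    using assms by (auto simp: P_set_iff[OF assms(1)] H.in_sccs_verts_conv_reachable)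
  then show ?thesis
  proof (induction rule: H.reachable_induct)
    case base
    show ?case by simp
  next
    case (step x y)
    then have "(x, y) \<in> parcs G" "x \<notin> T" "y \<notin> T"
      by (auto simp: arcs_ends_def arc_to_ends_def)
    then show ?case using step edge by auto
  qed
qed

section \<open>The basis\<close>

text \<open>
  The exponents are shifted by one so that the monomial has support exactly \<open>T\<close>.  This makes the
  pairs \<open>(T, a)\<close> with \<open>a\<close> in \<open>Z_set T\<close> correspond bijectively to all monomials.
\<close>

definition exponent_monomial :: "nat set \<Rightarrow> (nat \<Rightarrow> nat) \<Rightarrow> (nat \<Rightarrow>\<^sub>0 nat)" where
  "exponent_monomial T a = (\<Sum>t\<in>T. Poly_Mapping.single t (1 + a t))"

lemma lookup_exponent_monomial:
  "finite T \<Longrightarrow> Poly_Mapping.lookup (exponent_monomial T a) t = (if t \<in> T then 1 + a t else 0)"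
  by (simp add: exponent_monomial_def lookup_sum lookup_single when_def)

lemma keys_exponent_monomial: "finite T \<Longrightarrow> Poly_Mapping.keys (exponent_monomial T a) = T"
  by (auto simp: in_keys_iff lookup_exponent_monomial split: if_splits)

lemma exponent_monomial_inject:
  assumes "finite T" "finite T'" "a \<in> Z_set T" "a' \<in> Z_set T'"
    and eq: "exponent_monomial T a = exponent_monomial T' a'"
  shows "T = T' \<and> a = a'"
proof
  show T: "T = T'"
    using arg_cong[OF eq, of Poly_Mapping.keys] assms(1,2) by (simp add: keys_exponent_monomial)
  show "a = a'"
  proof
    fix t
    show "a t = a' t"
      using arg_cong[OF eq, of "\<lambda>m. Poly_Mapping.lookup m t"] assms T
      by (auto simp: lookup_exponent_monomial Z_set_def split: if_splits)
  qed
qed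

lemma exponent_monomial_keys:
  "exponent_monomial (Poly_Mapping.keys m) (\<lambda>t. Poly_Mapping.lookup m t - 1) = m"
  by (rule poly_mapping_eqI) (auto simp: lookup_exponent_monomial in_keys_iff)

lemma lookup_theta:
  assumes "finite W" "finite T"
  shows "Poly_Mapping.lookup (theta W T a :: 'k::field der) v =
    (if v \<in> W then shifted_monomial v (exponent_monomial T a) else 0)"
  using assms by (simp add: theta_def lookup_sum lookup_single when_def
      shifted_monomial_def keys_exponent_monomial lookup_exponent_monomial)

text \<open>
  The coordinates of \<open>\<theta>\<close>: this duality yields both the independence and the coefficients needed
  to express a given logarithmic derivation.
\<close>

lemma coefficient_theta:
  assumes "finite W" "finite T" "W \<inter> T = {}" "v \<notin> Poly_Mapping.keys m"
  shows "Poly_Mapping.lookup (Poly_Mapping.lookup (theta W T a :: 'k::field der) v) m =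
    (if v \<in> W \<and> m = exponent_monomial T a then 1 else 0)"
proof (cases "v \<in> W")
  case True
  then have "v \<notin> Poly_Mapping.keys (exponent_monomial T a)"
    using assms by (auto simp: keys_exponent_monomial)
  then show ?thesis
    using True assms by (auto simp: lookup_theta lookup_shifted_monomial)
qed (use assms in \<open>simp add: lookup_theta\<close>)

text \<open>
  An edge between \<open>W\<close> and a vertex \<open>v\<close> outside \<open>W\<close> must end in \<open>T\<close>, and then
  \<open>x\<^sub>v - x\<^sub>u\<close> is one of the factors of the coefficient at the end \<open>u\<close> in \<open>W\<close>.  For an edge inside \<open>W\<close> the two
  coefficients agree modulo \<open>x\<^sub>u - x\<^sub>v\<close>, factor by factor.
\<close>

lemma theta_in_log_der_R:
  assumes G: "pair_graph G" "pverts G = {1..l}" and WT: "(W, T) \<in> P_set G"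
  shows "(theta W T a :: 'k::field der) \<in> log_der_R l G"
proof -
  interpret pair_graph G by fact
  note sub = P_set_subset[OF G(1) WT, unfolded G(2)]
  have fin: "finite W" "finite T"
    using sub(1,2) by (auto intro: finite_subset)
  have R: "X t - X v \<in> R_ring l" if "t \<in> T" "v \<in> W" for t v
    using sub that by (intro X_diff_in_R_ring) auto
  have look: "Poly_Mapping.lookup (theta W T a :: 'k der) v =
      (if v \<in> W then \<Prod>t\<in>T. (X t - X v) ^ (1 + a t) else 0)" for v
    using fin by (simp add: theta_def lookup_sum lookup_single when_def)
  have inR: "Poly_Mapping.lookup (theta W T a :: 'k der) v \<in> R_ring l" for v
    using R unfolding look R_ring_def
    by (auto intro!: subalgebra_prod subalgebra.mult subalgebra_power subalgebra_0)
  have S: "X t - X v \<in> (S_ring l :: 'k mpoly set)" if "t \<in> T" "v \<in> W" for t v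
    using R[OF that] R_ring_subset_S_ring by blast
  \<comment> \<open>the case of one endpoint in \<open>W\<close> and the other in \<open>T\<close>\<close>
  have factor: "\<exists>q\<in>S_ring l. Poly_Mapping.lookup (theta W T a :: 'k der) u = (X u - X v) * q"
    if "u \<in> W" "v \<in> T" for u v
  proof -
    let ?q = "- ((X v - X u) ^ a v * (\<Prod>t\<in>T - {v}. (X t - X u) ^ (1 + a t))) :: 'k mpoly"
    have "Poly_Mapping.lookup (theta W T a :: 'k der) u = (X u - X v) * ?q"
      using that fin by (simp add: look prod.remove[of T v] algebra_simps)
    moreover have "?q \<in> S_ring l"
      using S that unfolding S_ring_def
      by (intro subalgebra_uminus subalgebra.mult subalgebra_power subalgebra_prod) auto
    ultimately show ?thesis by blast
  qed
  have "\<exists>q\<in>S_ring l. Poly_Mapping.lookup (theta W T a :: 'k der) u -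
      Poly_Mapping.lookup (theta W T a) v = (X u - X v) * q" if uv: "(u, v) \<in> parcs G" for u v
  proof -
    have vu: "(v, u) \<in> parcs G"
      using uv sym_arcs by (auto simp: symmetric_def sym_def)
    consider "u \<in> W" "v \<in> W" | "u \<in> W" "v \<in> T" "v \<notin> W" | "v \<in> W" "u \<in> T" "u \<notin> W" | "u \<notin> W" "v \<notin> W"
      using P_set_closed[OF G(1) WT uv] P_set_closed[OF G(1) WT vu] by blast
    then show ?thesis
    proof cases
      case 1
      have "\<exists>q\<in>S_ring l. (X t - X u) - (X t - X v) = (X u - X v) * (q :: 'k mpoly)" for t
        by (rule bexI[of _ "-1"])
           (auto simp: S_ring_def intro: subalgebra_uminus subalgebra_1)
      then have "\<exists>q\<in>S_ring l. (\<Prod>t\<in>T. (X t - X u) ^ (1 + a t)) -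
          (\<Prod>t\<in>T. (X t - X v) ^ (1 + a t)) = (X u - X v) * (q :: 'k mpoly)"
        using S 1 unfolding S_ring_def
        by (intro subalgebra_cong_prod subalgebra_cong_power subalgebra_power) blast+
      then show ?thesis using 1 by (simp add: look)
    next
      case 2
      then show ?thesis using factor[of u v] by (simp add: look)
    next
      case 3
      then obtain q where "q \<in> S_ring l"
        "Poly_Mapping.lookup (theta W T a :: 'k der) v = (X v - X u) * q"
        using factor by blast
      then show ?thesis
        using 3 by (intro bexI[of _ q]) (auto simp: look[of u] algebra_simps)
    next
      case 4
      then show ?thesis by (auto simp: look S_ring_def intro: bexI[of _ 0] subalgebra_0)
    qed
  qed
  moreover have "Poly_Mapping.keys (theta W T a :: 'k der) \<subseteq> {1..l}"
    using sub by (auto simp: in_keys_iff look split: if_splits)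
  ultimately show ?thesis
    unfolding log_der_R_iff[OF G(1)] using inR by blast
qed

lemma lookup_const_mult:
  "Poly_Mapping.lookup (const c * p :: 'k::field mpoly) m = c * Poly_Mapping.lookup p m"
  unfolding const_def by (simp flip: mult_map_scale_conv_mult add: Poly_Mapping.map.rep_eq when_def)

text \<open>
  The combination \<open>\<eta>\<close> of basis elements is chosen to have the coordinates of \<open>\<theta>\<close>.  Then
  \<open>\<theta> - \<eta>\<close> lies over $R$ with all coordinates zero, so it vanishes.
\<close>

lemma log_der_R_subset_span:
  fixes \<theta> :: "'k::field der"
  assumes G: "pair_graph G" "pverts G = {1..l}" and \<theta>: "\<theta> \<in> log_der_R l G"
  shows "\<theta> \<in> der.span {theta W T a | W T a. (W, T) \<in> P_set G \<and> a \<in> Z_set T}"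
    (is "_ \<in> der.span ?B")
proof -
  define M where "M = {m \<in> (\<Union>v\<in>{1..l}. Poly_Mapping.keys (Poly_Mapping.lookup \<theta> v)).
    Poly_Mapping.keys m \<subset> {1..l}}"
  define comps where "comps m = {W. (W, Poly_Mapping.keys m) \<in> P_set G}" for m :: "nat \<Rightarrow>\<^sub>0 nat"
  define th :: "nat set \<Rightarrow> (nat \<Rightarrow>\<^sub>0 nat) \<Rightarrow> 'k der" where
    "th W m = theta W (Poly_Mapping.keys m) (\<lambda>t. Poly_Mapping.lookup m t - 1)" for W m
  \<comment> \<open>the coordinate of \<open>\<theta>\<close> at \<open>m\<close> is the same at all vertices of the component \<open>W\<close>, so any
    vertex may be chosen\<close>
  define c where "c W m = Poly_Mapping.lookup (Poly_Mapping.lookup \<theta> (SOME w. w \<in> W)) m" for W m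
  define \<eta> where "\<eta> = (\<Sum>m\<in>M. \<Sum>W\<in>comps m. der_scale (c W m) (th W m))"
  have finM: "finite M"
    by (simp add: M_def)
  have comps: "W \<subseteq> {1..l}" "W \<inter> Poly_Mapping.keys m = {}" "W \<noteq> {}" "finite W" if "W \<in> comps m" for W m
    using P_set_subset[OF G(1), of W "Poly_Mapping.keys m"] that
    by (auto simp: comps_def G(2) intro: finite_subset)
  have fincomps: "finite (comps m)" for m
  proof (rule finite_subset)
    show "comps m \<subseteq> Pow {1..l}"
      using comps(1) by blast
  qed simp
  have th: "th W m \<in> ?B" if "W \<in> comps m" for W m
  proof -
    have "(\<lambda>t. Poly_Mapping.lookup m t - 1) \<in> Z_set (Poly_Mapping.keys m)"
      by (auto simp: Z_set_def in_keys_iff)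
    then show ?thesis
      using that unfolding th_def comps_def by blast
  qed
  then have span: "\<eta> \<in> der.span ?B"
    unfolding \<eta>_def by (intro der.span_sum der.span_scale der.span_base)
  have "?B \<subseteq> log_der_R l G"
    using theta_in_log_der_R[OF G] by blast
  then have \<eta>: "\<eta> \<in> log_der_R l G"
    using span der.span_minimal[OF _ subspace_log_der_R[OF G(1)]] by blast
  have "Poly_Mapping.lookup (Poly_Mapping.lookup \<eta> v) n =
      Poly_Mapping.lookup (Poly_Mapping.lookup \<theta> v) n"
    if v: "v \<in> {1..l}" and vn: "v \<notin> Poly_Mapping.keys n" for v n
  proof -
    have "Poly_Mapping.lookup (Poly_Mapping.lookup \<eta> v) n =
        (\<Sum>m\<in>M. \<Sum>W\<in>comps m. c W m * (if v \<in> W \<and> n = m then 1 else 0))"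
      unfolding \<eta>_def lookup_sum lookup_der_scale lookup_const_mult
    proof (intro sum.cong refl)
      fix m W assume "W \<in> comps m"
      note coefficient = coefficient_theta[OF comps(4)[OF this] finite_keys comps(2)[OF this] vn]
      show "c W m * Poly_Mapping.lookup (Poly_Mapping.lookup (th W m) v) n =
          c W m * (if v \<in> W \<and> n = m then 1 else 0)"
        by (simp only: th_def coefficient exponent_monomial_keys)
    qed
    also have "\<dots> = (\<Sum>m\<in>M. if n = m then \<Sum>W\<in>comps m. c W m * (if v \<in> W then 1 else 0) else 0)"
      by (intro sum.cong) auto
    also have "\<dots> = (if n \<in> M then \<Sum>W\<in>comps n. c W n * (if v \<in> W then 1 else 0) else 0)"
      using finM by simp
    also have "\<dots> = Poly_Mapping.lookup (Poly_Mapping.lookup \<theta> v) n"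
    proof (cases "n \<in> M")
      case True
      then have "Poly_Mapping.keys n \<subseteq> pverts G"
        by (auto simp: M_def G(2))
      with v vn obtain W where W: "(W, Poly_Mapping.keys n) \<in> P_set G" "v \<in> W"
        using P_set_cover[OF G(1), of v "Poly_Mapping.keys n"] by (auto simp: G(2))
      have "(\<Sum>U\<in>comps n. c U n * (if v \<in> U then 1 else 0)) =
          (\<Sum>U\<in>comps n. if U = W then c U n else 0)"
        using P_set_disjoint[OF G(1) _ W(1)] W(2)
        by (intro sum.cong) (auto simp: comps_def)
      also have "\<dots> = c W n"
        using W fincomps by (simp add: comps_def)
      also have "\<dots> = Poly_Mapping.lookup (Poly_Mapping.lookup \<theta> v) n"
        unfolding c_def
        by (rule P_set_constant[OF G(1) W(1) someI[of "\<lambda>w. w \<in> W", OF W(2)] W(2),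
              of "\<lambda>w. Poly_Mapping.lookup (Poly_Mapping.lookup \<theta> w) n"])
           (rule lookup_eq_if_edge[OF G(1) \<theta>])
      finally show ?thesis using True by simp
    next
      case False
      have "Poly_Mapping.lookup \<theta> v \<in> S_ring l"
        using \<theta> v R_ring_subset_S_ring unfolding log_der_R_iff[OF G(1)] by blast
      then have "n \<notin> Poly_Mapping.keys (Poly_Mapping.lookup \<theta> v)"
        using keys_S_ring[of _ l n] False v vn by (auto simp: M_def)
      then show ?thesis using False by (simp add: in_keys_iff)
    qed
    finally show ?thesis .
  qed
  note coeff = this
  have diff: "\<theta> - \<eta> \<in> log_der_R l G"
    using \<theta> \<eta> subspace_log_der_R[OF G(1)] by (rule der.subspace_diff[rotated])
  have "\<theta> - \<eta> = 0"
  proof (rule poly_mapping_eqI)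
    fix v
    show "Poly_Mapping.lookup (\<theta> - \<eta>) v = Poly_Mapping.lookup 0 v"
    proof (cases "v \<in> {1..l}")
      case True
      have "Poly_Mapping.lookup (\<theta> - \<eta>) v \<in> R_ring l"
        using diff True unfolding log_der_R_iff[OF G(1)] by blast
      then have "Poly_Mapping.lookup (\<theta> - \<eta>) v = 0"
        by (rule R_ring_eq_0I[of _ l v]) (simp add: lookup_minus coeff[OF True])
      then show ?thesis by simp
    next
      case False
      then show ?thesis
        using diff unfolding log_der_R_iff[OF G(1)] by (auto simp: in_keys_iff)
    qed
  qed
  then show ?thesis using span by simp
qed

theorem proposition2p11:
  fixes l :: nat and G :: "nat pair_pre_digraph"
  defines "I \<equiv> {(W, T, a). (W, T) \<in> P_set G \<and> a \<in> Z_set T}"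
    and "\<Theta> \<equiv> (\<lambda>(W, T, a). theta W T a :: 'k::field der)"
  assumes "l \<ge> 1" and "pair_graph G" and "pverts G = {1..l}"
  shows "inj_on \<Theta> I \<and> der.independent (\<Theta> ` I) \<and> der.span (\<Theta> ` I) = log_der_R l G"
proof -
  note G = assms(4,5)
  \<comment> \<open>A dual coordinate for each index: take the vertex \<open>v\<close> in \<open>W\<close> and the monomial of \<open>(T, a)\<close>.
    The monomial determines \<open>(T, a)\<close>, and then \<open>v\<close> determines the component.\<close>
  have "\<exists>v m. \<forall>j\<in>I. Poly_Mapping.lookup (Poly_Mapping.lookup (\<Theta> j) v) m = (if j = i then 1 else 0)"
    if "i \<in> I" for i
  proof -
    obtain W T a where i: "i = (W, T, a)" and WT: "(W, T) \<in> P_set G" and a: "a \<in> Z_set T"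
      using \<open>i \<in> I\<close> by (auto simp: I_def)
    note sub = P_set_subset[OF G(1) WT, unfolded G(2)]
    obtain v where v: "v \<in> W" using sub(3) by blast
    have finT: "finite T" using sub(1) by (auto intro: finite_subset)
    have vT: "v \<notin> Poly_Mapping.keys (exponent_monomial T a)"
      using sub(2) v finT by (auto simp: keys_exponent_monomial)
    have "Poly_Mapping.lookup (Poly_Mapping.lookup (\<Theta> j) v) (exponent_monomial T a) =
        (if j = i then 1 else 0)" if "j \<in> I" for j
    proof -
      obtain W' T' a' where j: "j = (W', T', a')" and WT': "(W', T') \<in> P_set G"
        and a': "a' \<in> Z_set T'"
        using \<open>j \<in> I\<close> by (auto simp: I_def)
      note sub' = P_set_subset[OF G(1) WT', unfolded G(2)]
      have fin': "finite W'" "finite T'" "W' \<inter> T' = {}"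
        using sub' by (auto intro: finite_subset)
      have "v \<in> W' \<and> exponent_monomial T a = exponent_monomial T' a' \<longleftrightarrow> j = i"
        using exponent_monomial_inject[OF finT fin'(2) a a'] P_set_disjoint[OF G(1) WT _ v]
          WT' v by (auto simp: i j)
      then show ?thesis
        using coefficient_theta[OF fin' vT, of a', where 'k = 'k] by (simp add: \<Theta>_def j)
    qed
    then show ?thesis by blast
  qed
  then obtain v m where dual: "\<And>i j. i \<in> I \<Longrightarrow> j \<in> I \<Longrightarrow>
      Poly_Mapping.lookup (Poly_Mapping.lookup (\<Theta> j) (v i)) (m i) = (if j = i then 1 else 0)"
    by metis
  have inj: "inj_on \<Theta> I"
    by (rule inj_onI) (metis dual zero_neq_one)
  have "der.independent (\<Theta> ` I)"
    unfolding der.independent_explicit_module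
  proof (intro allI impI)
    fix t u x
    assume fin: "finite t" and t: "t \<subseteq> \<Theta> ` I" and zero: "(\<Sum>y\<in>t. der_scale (u y) y) = 0" and x: "x \<in> t"
    obtain i where i: "i \<in> I" "x = \<Theta> i" using t x by blast
    have "0 = Poly_Mapping.lookup (Poly_Mapping.lookup (\<Sum>y\<in>t. der_scale (u y) y) (v i)) (m i)"
      by (simp add: zero)
    also have "\<dots> = (\<Sum>y\<in>t. if y = x then u y else 0)"
      unfolding lookup_sum lookup_der_scale lookup_const_mult
    proof (intro sum.cong refl)
      fix y assume "y \<in> t"
      then obtain j where j: "j \<in> I" "y = \<Theta> j" using t by blast
      then have "y = x \<longleftrightarrow> j = i" using inj_onD[OF inj] i by blast
      then show "u y * Poly_Mapping.lookup (Poly_Mapping.lookup y (v i)) (m i) =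
          (if y = x then u y else 0)"
        using dual[OF i(1) j(1)] j by simp
    qed
    also have "\<dots> = u x" using fin x by simp
    finally show "u x = 0" by simp
  qed
  moreover have B: "\<Theta> ` I = {theta W T a | W T a. (W, T) \<in> P_set G \<and> a \<in> Z_set T}"
    unfolding \<Theta>_def I_def by (auto simp: image_iff) blast
  have "der.span (\<Theta> ` I) = log_der_R l G"
  proof
    show "der.span (\<Theta> ` I) \<subseteq> log_der_R l G"
      using theta_in_log_der_R[OF G] unfolding B
      by (intro der.span_minimal subspace_log_der_R[OF G(1)]) blast
    show "log_der_R l G \<subseteq> der.span (\<Theta> ` I)"
      unfolding B using log_der_R_subset_span[OF G] by blast
  qed
  ultimately show ?thesis using inj by blast
qed

end
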